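(* Let $\mathbb X=\hat{\mathbb X}=\mathbb R^n$, let $\mathbb U=\hat{\mathbb U}\subset\mathbb R^m$, let $A\in\mathbb R^{n\times n}$, $B\in\mathbb R^{n\times m}$ and $C$ (a matrix with $n$ columns) be known, and let $\Theta\subset\mathbb R^n$ be a bounded polytope. For $\theta\in\Theta$ consider the linear system $$\mathbf M(\theta):\quad x_{k+1}=Ax_k+Bu_k+w_k+\theta,\qquad y_k=Cx_k,$$ and the nominal model $$\widehat{\mathbf M}:\quad \hat x_{k+1}=A\hat x_k+B\hat u_k+\hat w_k,\qquad \hat y_k=C\hat x_k,$$ where $(w_k)$ and $(\hat w_k)$ are i.i.d. with distribution $\mathcal N(0,I)$, and the initial states satisfy $\hat x_0=x_0$. Let $$\delta=\sup_{\theta\in\Theta}\Big\{1-2\,\mathrm{cdf}\big(-\tfrac12\|\theta\|\big)\Big\},\qquad \mathrm{cdf}(\alpha)=\int_{-\infty}^{\alpha}\tfrac{1}{\sqrt{2\pi}}e^{-\beta^2/2}\,d\beta,\qquad \varepsilon=0.$$ Then for every $\theta\in\Theta$, $\widehat{\mathbf M}\preceq^{\delta}_{\varepsilon}\mathbf M(\theta)$, with interface function $u_k=\hat u_k$, relation $\mathcal R=\{(\hat x,x)\in\hat{\mathbb X}\times\mathbb X: x=\hat x\}$, and sub-probability kernel $$\boldsymbol v(d\hat x^+\times dx^+\mid\hat x,x,\hat u;\theta)=\int_{\hat w}\int_{w}\delta_{A\hat x+B\hat u+\hat w}(d\hat x^+)\,\delta_{Ax+Bu+\theta+w}(dx^+)\,\delta_{\theta+w}(d\hat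 w)\,\min\{\mathcal N(dw\mid0,I),\mathcal N(dw\mid-\theta,I)\},$$ where $u=\hat u$. Moreover, the state mapping, which does not depend on $\theta$, $$\mathbf s(d\hat x^+\mid\hat x,x,x^+,\hat u)=\delta_{x^+-A(x-\hat x)-B(u-\hat u)}(d\hat x^+),\qquad u=\hat u,$$ defines a valid control refinement (with respect to this interface function and $\boldsymbol v(\cdot;\theta)$) for every $\theta\in\Theta$.
   Context: All spaces are Polish with Borel $\sigma$-algebras. $\delta_a$ with a point subscript denotes the Dirac measure at $a$ (the scalar $\delta$ is unrelated); $\mathcal N(\cdot\mid m,\Sigma)$ is the Gaussian measure with mean $m$ and covariance $\Sigma$; $\|\cdot\|$ is the Euclidean norm; the minimum of two measures having Lebesgue densities is the measure whose density is the pointwise minimum of the densities. A general Markov decision process (gMDP) is a tuple $\mathbf M=(\mathbb X,x_0,\mathbb U,\mathbf t,h,\mathbb Y)$ with state space $\mathbb X$, initial state $x_0\in\mathbb X$, input space $\mathbb U$, probability kernel $\mathbf t(\cdot\mid x,u)$ on $\mathbb X$ given $(x,u)$, and measurable output map $h:\mathbb X\to\mathbb Y$, with a metric $\mathbf d_{\mathbb Y}$ on $\mathbb Y$. The systems in the claim are regarded as gMDPs with a common metric output space and transition kernels $\mathbf t(\cdot\mid x,u;\theta)=\mathcal N(\cdot\mid Ax+Bu+\theta,I)$ and $\hat{\mathbf t}(\cdot\mid\hat x,\hat u)=\mathcal N(\cdot\mid A\hat x+B\hat u,I)$, and output maps $x\mapsto Cx$, $\hat x\mapsto C\hat x$. Interface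 function: a measurable rule $\mathbf i$ assigning to $(\hat x,x,\hat u)$ an input $u\in\mathbb U$ for $\mathbf M$; here $\mathbf i(\hat x,x,\hat u)=\hat u$. Sub-probability coupling: given probability measures $p$ on $\mathbb X$ and $\hat p$ on $\hat{\mathbb X}$, $\mathcal R\subset\hat{\mathbb X}\times\mathbb X$ and $\delta\in[0,1]$, a measure $v$ on $\hat{\mathbb X}\times\mathbb X$ of total mass at most $1$ and with $v(\hat{\mathbb X}\times\mathbb X)\ge1-\delta$ is a sub-probability coupling of $\hat p$ and $p$ over $\mathcal R$ (with respect to $\delta$) if (a) $v(\hat{\mathbb X}\times\mathbb X)=v(\mathcal R)$; (b) $v(S\times\mathbb X)\le\hat p(S)$ for all measurable $S\subset\hat{\mathbb X}$; (c) $v(\hat{\mathbb X}\times S)\le p(S)$ for all measurable $S\subset\mathbb X$. $(\varepsilon,\delta)$-sub-simulation relation: $\widehat{\mathbf M}\preceq^\delta_\varepsilon\mathbf M$, with measurable relation $\mathcal R\subset\hat{\mathbb X}\times\mathbb X$, interface function $\mathbf i$ and sub-probability kernel $\boldsymbol v(\cdot\mid\hat x,x,\hat u)$ on $\hat{\mathbb X}\times\mathbb X$, means: (a) $(\hat x_0,x_0)\in\mathcal R$; (b) for all $(\hat x,x)\in\mathcal R$ and $\hat u\in\hat{\mathbb U}$, $\boldsymbol v(\cdot\mid\hat x,x,\hat u)$ is a sub-probability coupling of $\hat{\mathbf t}(\cdot\mid\hat x,\hat u)$ and $\mathbf t(\cdot\mid x,\mathbf i(\hat x,x,\hat u))$ over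 $\mathcal R$ with respect to $\delta$; (c) $\mathbf d_{\mathbb Y}(\hat h(\hat x),h(x))\le\varepsilon$ for all $(\hat x,x)\in\mathcal R$. Valid control refinement: a stochastic kernel (state mapping) $\mathbf s(\cdot\mid\hat x,x,x^+,\hat u)$ on $\hat{\mathbb X}$ defines a valid control refinement for $\mathbf i$ and $\boldsymbol v$ if for all measurable $S\subset\hat{\mathbb X}\times\mathbb X$, all $(\hat x,x)\in\mathcal R$ and all $\hat u\in\hat{\mathbb U}$, $$\int_{(\hat x^+,x^+)\in S}\mathbf s(d\hat x^+\mid\hat x,x,x^+,\hat u)\,\mathbf t(dx^+\mid x,\mathbf i(\hat x,x,\hat u))\ge\boldsymbol v(S\mid\hat x,x,\hat u).$$ *)

theory Defs
  imports "HOL-Probability.Probability"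
begin

definition polish_topology :: "'a topology \<Rightarrow> bool" where
  "polish_topology T \<longleftrightarrow> completely_metrizable_space T \<and> second_countable T"

definition borel_of_top :: "'a topology \<Rightarrow> 'a measure" where
  "borel_of_top T = sigma (topspace T) {S. openin T S}"


section \<open>General Markov decision processes\<close>

text \<open>Spaces are topologies on carriers, so that proper subsets (such as an input set in
  Euclidean space) are allowed. Kernels are total functions; only their values on the carriers
  are constrained or used. The output metric is not required to induce the output topology.\<close>

record ('x, 'u, 'y) gmdp =
  states :: "'x topology"
  init_state :: 'x
  inputs :: "'u topology"
  trans_kernel :: "'x \<Rightarrow> 'u \<Rightarrow> 'x measure"
  out_map :: "'x \<Rightarrow> 'y"
  outputs :: "'y topology"
  out_metric :: "'y \<Rightarrow> 'y \<Rightarrow> real"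

definition is_gmdp :: "('x, 'u, 'y) gmdp \<Rightarrow> bool" where
  "is_gmdp M \<longleftrightarrow>
     polish_topology (states M) \<and> polish_topology (inputs M) \<and> polish_topology (outputs M) \<and>
     init_state M \<in> topspace (states M) \<and>
     (\<lambda>(x, u). trans_kernel M x u) \<in>
       borel_of_top (states M) \<Otimes>\<^sub>M borel_of_top (inputs M)
         \<rightarrow>\<^sub>M prob_algebra (borel_of_top (states M)) \<and>
     out_map M \<in> borel_of_top (states M) \<rightarrow>\<^sub>M borel_of_top (outputs M) \<and>
     Metric_space (topspace (outputs M)) (out_metric M)"


section \<open>Sub-simulation relations and control refinement\<close>

definition subprob_coupling ::
  "real \<Rightarrow> ('a \<times> 'b) set \<Rightarrow> 'a measure \<Rightarrow> 'b measure \<Rightarrow> ('a \<times> 'b) measure \<Rightarrow> bool" where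
  "subprob_coupling \<delta> R p' p v \<longleftrightarrow>
     0 \<le> \<delta> \<and> \<delta> \<le> 1 \<and>
     sets v = sets (p' \<Otimes>\<^sub>M p) \<and> R \<in> sets v \<and>
     emeasure v (space v) \<le> 1 \<and>
     emeasure v (space v) \<ge> ennreal (1 - \<delta>) \<and>
     emeasure v (space v) = emeasure v R \<and>
     (\<forall>S\<in>sets p'. emeasure v (S \<times> space p) \<le> emeasure p' S) \<and>
     (\<forall>S\<in>sets p. emeasure v (space p' \<times> S) \<le> emeasure p S)"

text \<open>The first model (written with a prime) is the abstract one. Interface functions and
  sub-probability kernels take the arguments (abstract state, state, abstract input).\<close>

definition is_interface ::
  "('a, 'c, 'y) gmdp \<Rightarrow> ('b, 'd, 'y) gmdp \<Rightarrow> ('a \<Rightarrow> 'b \<Rightarrow> 'c \<Rightarrow> 'd) \<Rightarrow> bool" where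
  "is_interface M' M i \<longleftrightarrow>
     (\<lambda>(x', x, u'). i x' x u') \<in>
       borel_of_top (states M') \<Otimes>\<^sub>M borel_of_top (states M) \<Otimes>\<^sub>M borel_of_top (inputs M')
         \<rightarrow>\<^sub>M borel_of_top (inputs M)"

definition is_subprob_kernel ::
  "('a, 'c, 'y) gmdp \<Rightarrow> ('b, 'd, 'y) gmdp \<Rightarrow> ('a \<Rightarrow> 'b \<Rightarrow> 'c \<Rightarrow> ('a \<times> 'b) measure) \<Rightarrow> bool" where
  "is_subprob_kernel M' M v \<longleftrightarrow>
     (\<lambda>(x', x, u'). v x' x u') \<in>
       borel_of_top (states M') \<Otimes>\<^sub>M borel_of_top (states M) \<Otimes>\<^sub>M borel_of_top (inputs M')
         \<rightarrow>\<^sub>M subprob_algebra (borel_of_top (states M') \<Otimes>\<^sub>M borel_of_top (states M))"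

definition sub_simulation ::
  "real \<Rightarrow> real \<Rightarrow> ('a, 'c, 'y) gmdp \<Rightarrow> ('b, 'd, 'y) gmdp \<Rightarrow> ('a \<times> 'b) set
     \<Rightarrow> ('a \<Rightarrow> 'b \<Rightarrow> 'c \<Rightarrow> 'd) \<Rightarrow> ('a \<Rightarrow> 'b \<Rightarrow> 'c \<Rightarrow> ('a \<times> 'b) measure) \<Rightarrow> bool" where
  "sub_simulation \<epsilon> \<delta> M' M R i v \<longleftrightarrow>
     is_gmdp M' \<and> is_gmdp M \<and>
     outputs M' = outputs M \<and> out_metric M' = out_metric M \<and>
     R \<in> sets (borel_of_top (states M') \<Otimes>\<^sub>M borel_of_top (states M)) \<and>
     is_interface M' M i \<and>
     is_subprob_kernel M' M v \<and>
     (init_state M', init_state M) \<in> R \<and>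
     (\<forall>(x', x)\<in>R. \<forall>u'\<in>topspace (inputs M').
        subprob_coupling \<delta> R (trans_kernel M' x' u') (trans_kernel M x (i x' x u')) (v x' x u')) \<and>
     (\<forall>(x', x)\<in>R. out_metric M (out_map M' x') (out_map M x) \<le> \<epsilon>)"

text \<open>A state mapping takes the arguments (abstract state, state, next state, abstract input).\<close>

definition valid_control_refinement ::
  "('a, 'c, 'y) gmdp \<Rightarrow> ('b, 'd, 'y) gmdp \<Rightarrow> ('a \<times> 'b) set
     \<Rightarrow> ('a \<Rightarrow> 'b \<Rightarrow> 'c \<Rightarrow> 'd) \<Rightarrow> ('a \<Rightarrow> 'b \<Rightarrow> 'c \<Rightarrow> ('a \<times> 'b) measure)
     \<Rightarrow> ('a \<Rightarrow> 'b \<Rightarrow> 'b \<Rightarrow> 'c \<Rightarrow> 'a measure) \<Rightarrow> bool" where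
  "valid_control_refinement M' M R i v s \<longleftrightarrow>
     (\<lambda>(x', x, y, u'). s x' x y u') \<in>
       borel_of_top (states M') \<Otimes>\<^sub>M borel_of_top (states M)
         \<Otimes>\<^sub>M borel_of_top (states M) \<Otimes>\<^sub>M borel_of_top (inputs M')
         \<rightarrow>\<^sub>M prob_algebra (borel_of_top (states M')) \<and>
     (\<forall>S\<in>sets (borel_of_top (states M') \<Otimes>\<^sub>M borel_of_top (states M)).
        \<forall>(x', x)\<in>R. \<forall>u'\<in>topspace (inputs M').
          (\<integral>\<^sup>+ y. \<integral>\<^sup>+ y'. indicator S (y', y) \<partial>s x' x y u' \<partial>trans_kernel M x (i x' x u'))
            \<ge> emeasure (v x' x u') S)"


section \<open>Gaussian measures\<close>

text \<open>Meaningful for positive definite covariance matrices only.\<close>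

definition gaussian :: "real ^ 'n \<Rightarrow> real ^ 'n ^ 'n \<Rightarrow> (real ^ 'n) measure" where
  "gaussian m \<Sigma> = density lborel (\<lambda>x. ennreal
     (exp (- ((x - m) \<bullet> (matrix_inv \<Sigma> *v (x - m))) / 2)
        / sqrt ((2 * pi) ^ CARD('n) * det \<Sigma>)))"

text \<open>The pointwise minimum of Lebesgue densities; unlike the lattice infimum on measures, this
  refers to the densities directly. It only makes sense for absolutely continuous measures.\<close>

definition min_measure ::
  "'a::euclidean_space measure \<Rightarrow> 'a measure \<Rightarrow> 'a measure" where
  "min_measure \<mu> \<nu> = density lborel (\<lambda>x. min (RN_deriv lborel \<mu> x) (RN_deriv lborel \<nu> x))"

definition std_normal_cdf :: "real \<Rightarrow> real" where
  "std_normal_cdf \<alpha> = (LBINT \<beta>:{..\<alpha>}. 1 / sqrt (2 * pi) * exp (- \<beta>\<^sup>2 / 2))"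


section \<open>The linear models\<close>

text \<open>The models \<open>x\<^sub>k\<^sub>+\<^sub>1 = A x\<^sub>k + B u\<^sub>k + w\<^sub>k + \<theta>\<close> and
  \<open>x\<^sub>k\<^sub>+\<^sub>1 = A x\<^sub>k + B u\<^sub>k + w\<^sub>k\<close> with i.i.d. standard Gaussian \<open>w\<^sub>k\<close> and
  output \<open>C x\<^sub>k\<close>; \<open>U\<close> is the input set, \<open>d\<close> the output metric.\<close>

definition linear_model ::
  "real ^ 'n ^ 'n \<Rightarrow> real ^ 'm ^ 'n \<Rightarrow> real ^ 'n ^ 'p \<Rightarrow> (real ^ 'm) set
     \<Rightarrow> (real ^ 'p \<Rightarrow> real ^ 'p \<Rightarrow> real) \<Rightarrow> real ^ 'n \<Rightarrow> real ^ 'n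
     \<Rightarrow> (real ^ 'n, real ^ 'm, real ^ 'p) gmdp" where
  "linear_model A B C U d x0 \<theta> =
     \<lparr>states = euclidean, init_state = x0, inputs = top_of_set U,
      trans_kernel = (\<lambda>x u. gaussian (A *v x + B *v u + \<theta>) (mat 1)),
      out_map = (\<lambda>x. C *v x), outputs = euclidean, out_metric = d\<rparr>"

definition nominal_model ::
  "real ^ 'n ^ 'n \<Rightarrow> real ^ 'm ^ 'n \<Rightarrow> real ^ 'n ^ 'p \<Rightarrow> (real ^ 'm) set
     \<Rightarrow> (real ^ 'p \<Rightarrow> real ^ 'p \<Rightarrow> real) \<Rightarrow> real ^ 'n
     \<Rightarrow> (real ^ 'n, real ^ 'm, real ^ 'p) gmdp" where
  "nominal_model A B C U d x0 =
     \<lparr>states = euclidean, init_state = x0, inputs = top_of_set U,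
      trans_kernel = (\<lambda>x u. gaussian (A *v x + B *v u) (mat 1)),
      out_map = (\<lambda>x. C *v x), outputs = euclidean, out_metric = d\<rparr>"

definition same_input :: "real ^ 'n \<Rightarrow> real ^ 'n \<Rightarrow> real ^ 'm \<Rightarrow> real ^ 'm" where
  "same_input x' x u' = u'"

definition shift_coupling ::
  "real ^ 'n ^ 'n \<Rightarrow> real ^ 'm ^ 'n \<Rightarrow> real ^ 'n
     \<Rightarrow> real ^ 'n \<Rightarrow> real ^ 'n \<Rightarrow> real ^ 'm \<Rightarrow> ((real ^ 'n) \<times> (real ^ 'n)) measure" where
  "shift_coupling A B \<theta> x' x u' =
     (let u = same_input x' x u' in
      min_measure (gaussian 0 (mat 1)) (gaussian (- \<theta>) (mat 1)) \<bind> (\<lambda>w.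
      return borel (\<theta> + w) \<bind> (\<lambda>w'.
      return borel (A *v x' + B *v u' + w') \<Otimes>\<^sub>M return borel (A *v x + B *v u + \<theta> + w))))"

definition refinement_map ::
  "real ^ 'n ^ 'n \<Rightarrow> real ^ 'm ^ 'n
     \<Rightarrow> real ^ 'n \<Rightarrow> real ^ 'n \<Rightarrow> real ^ 'n \<Rightarrow> real ^ 'm \<Rightarrow> (real ^ 'n) measure" where
  "refinement_map A B x' x y u' =
     (let u = same_input x' x u' in
      return borel (y - A *v (x - x') - B *v (u - u')))"

end

theory Submission
  imports Defs
begin

text \<open>Both components of \<open>shift_coupling A B \<theta> x' x u\<close> are affine functions of one variable \<open>w\<close>
  drawn from \<open>min (N(0, I), N(- \<theta>, I))\<close>, and on the diagonal \<open>x' = x\<close> they coincide; so the mass stays on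
  the diagonal. Bounding the minimum by \<open>N(- \<theta>, I)\<close> and by \<open>N(0, I)\<close> gives the two marginals; the second
  bound also gives the refinement, as the state mapping is then \<open>\<delta>\<^bsub>x\<^sup>+\<^esub>\<close>. The total mass is
  computed from the fact that the projection of a standard Gaussian vector on a unit vector is a
  standard normal variable.\<close>

section \<open>Standard Gaussian measures\<close>

text \<open>The product over coordinates, rather than the exponential of the squared norm, is taken
  as primitive because integrals over boxes then factor directly. Working over any Euclidean space
  keeps this part free of vectors \<open>real ^ 'n\<close>.\<close>

definition std_gauss_density :: "'a::euclidean_space \<Rightarrow> real" where
  "std_gauss_density x = (\<Prod>b\<in>Basis. std_normal_density (x \<bullet> b))"

definition std_gauss :: "'a::euclidean_space measure" where
  "std_gauss = density lborel (\<lambda>x. ennreal (std_gauss_density x))"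

lemma std_gauss_density_measurable [measurable]: "std_gauss_density \<in> borel_measurable borel"
  unfolding std_gauss_density_def by measurable

text \<open>The closed form serves two ends: it identifies the density with that of
  \<open>gaussian\<close>, and it shows that the density at \<open>x\<close> depends only on
  \<open>x \<bullet> x\<close> and decreases in it.\<close>

lemma std_gauss_density_eq:
  "std_gauss_density (x :: 'a::euclidean_space) = exp (- (x \<bullet> x) / 2) / sqrt ((2 * pi) ^ DIM('a))"
proof -
  have "std_gauss_density x = (1 / sqrt (2 * pi)) ^ DIM('a) * exp (\<Sum>b\<in>Basis. - (x \<bullet> b)\<^sup>2 / 2)"
    by (simp only: std_gauss_density_def std_normal_density_def prod.distrib prod_constant
          exp_sum[OF finite_Basis])
  moreover have "(\<Sum>b\<in>Basis. - (x \<bullet> b)\<^sup>2 / 2) = - (x \<bullet> x) / 2"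
    by (subst euclidean_inner[of x x]) (simp add: power2_eq_square sum_negf sum_divide_distrib)
  ultimately show ?thesis
    by (simp only: power_one_over real_sqrt_power mult_1_left times_divide_eq_left)
qed

lemma sets_std_gauss [measurable_cong, simp]: "sets std_gauss = sets borel"
  by (simp add: std_gauss_def)

lemma space_std_gauss [simp]: "space std_gauss = UNIV"
  by (simp add: std_gauss_def)

text \<open>Density and indicator of a box are both products over the coordinates, so Fubini splits
  the integral. Total mass, coordinate laws and independence are all read off from this
  formula.\<close>

lemma emeasure_std_gauss_box:
  fixes E :: "'a::euclidean_space \<Rightarrow> real set"
  assumes [measurable]: "\<And>b. b \<in> Basis \<Longrightarrow> E b \<in> sets borel"
  shows "emeasure std_gauss {x. \<forall>b\<in>Basis. x \<bullet> b \<in> E b} =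
    (\<Prod>b\<in>Basis. emeasure (density lborel std_normal_density) (E b))"
proof -
  have [measurable]: "{x::'a. \<forall>b\<in>Basis. x \<bullet> b \<in> E b} \<in> sets borel"
  proof -
    have "{x::'a. \<forall>b\<in>Basis. x \<bullet> b \<in> E b} = (\<Inter>b\<in>Basis. (\<lambda>x. x \<bullet> b) -` E b \<inter> space borel)"
      by auto
    also have "\<dots> \<in> sets borel"
      by (intro sets.finite_INT measurable_sets[OF _ assms]) auto
    finally show ?thesis .
  qed
  have "emeasure std_gauss {x::'a. \<forall>b\<in>Basis. x \<bullet> b \<in> E b} =
      (\<integral>\<^sup>+x. (\<Prod>b\<in>Basis. ennreal (std_normal_density (x \<bullet> b)) * indicator (E b) (x \<bullet> b)) \<partial>(lborel :: 'a measure))"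
    unfolding std_gauss_def
    by (subst emeasure_density)
       (auto intro!: nn_integral_cong simp: std_gauss_density_def prod_ennreal prod.distrib
             indicator_def prod_zero_iff split: if_splits)
  also have "\<dots> = (\<Prod>b\<in>Basis. \<integral>\<^sup>+x. ennreal (std_normal_density x) * indicator (E b) x \<partial>lborel)"
    by (rule nn_integral_lborel_prod) auto
  also have "\<dots> = (\<Prod>b\<in>Basis. emeasure (density lborel std_normal_density) (E b))"
    by (intro prod.cong refl) (simp add: emeasure_density)
  finally show ?thesis .
qed

lemma prob_space_std_gauss: "prob_space (std_gauss :: 'a::euclidean_space measure)"
proof
  interpret N: prob_space "density lborel std_normal_density"
    by (rule prob_space_normal_density) simp
  show "emeasure (std_gauss :: 'a measure) (space std_gauss) = 1"
    using emeasure_std_gauss_box[of "\<lambda>_ :: 'a. UNIV"] N.emeasure_space_1 by simp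
qed

interpretation std_gauss: prob_space "std_gauss :: 'a::euclidean_space measure"
  by (rule prob_space_std_gauss)

text \<open>The preimage of \<open>E\<close> is a box with side \<open>E\<close> in direction
  \<open>b\<close> and the whole line in all other directions, each of which contributes a factor
  1.\<close>

lemma distr_std_gauss_component:
  assumes b: "b \<in> (Basis :: 'a::euclidean_space set)"
  shows "distr std_gauss borel (\<lambda>x. x \<bullet> b) = density lborel std_normal_density"
proof (rule measure_eqI)
  interpret N: prob_space "density lborel std_normal_density"
    by (rule prob_space_normal_density) simp
  fix E assume "E \<in> sets (distr std_gauss borel (\<lambda>x::'a. x \<bullet> b))"
  then have [measurable]: "E \<in> sets borel" by simp
  have "emeasure (distr std_gauss borel (\<lambda>x. x \<bullet> b)) E
      = emeasure std_gauss {x. \<forall>c\<in>Basis. x \<bullet> c \<in> (if c = b then E else UNIV)}"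
    using b by (subst emeasure_distr) (auto intro!: arg_cong[of _ _ "emeasure _"] split: if_splits)
  also have "\<dots> = (\<Prod>c\<in>Basis. emeasure (density lborel std_normal_density) (if c = b then E else UNIV))"
    by (rule emeasure_std_gauss_box) auto
  also have "\<dots> = (\<Prod>c\<in>Basis. if c = b then emeasure (density lborel std_normal_density) E else 1)"
    using N.emeasure_space_1 by (intro prod.cong) auto
  also have "\<dots> = emeasure (density lborel std_normal_density) E"
    using b by simp
  finally show "emeasure (distr std_gauss borel (\<lambda>x. x \<bullet> b)) E = emeasure (density lborel std_normal_density) E" .
qed simp

text \<open>The box formula says that the joint law of the coordinates agrees with the product
  measure on rectangles, and these determine it. Independence is then the equality of the joint law
  with the product of the marginals.\<close>

lemma indep_vars_std_gauss:
  "prob_space.indep_vars (std_gauss :: 'a::euclidean_space measure) (\<lambda>_. borel) (\<lambda>b x. x \<bullet> b) Basis"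
proof -
  interpret P: product_sigma_finite "\<lambda>b::'a. density lborel std_normal_density"
    by (intro product_sigma_finite.intro prob_space_imp_sigma_finite prob_space_normal_density) simp
  have "distr std_gauss (\<Pi>\<^sub>M b\<in>Basis. borel) (\<lambda>x. \<lambda>b\<in>Basis. x \<bullet> b)
      = (\<Pi>\<^sub>M b\<in>(Basis::'a set). density lborel std_normal_density)"
  proof (rule P.PiM_eqI)
    show "sets (distr std_gauss (\<Pi>\<^sub>M b\<in>(Basis::'a set). borel) (\<lambda>x. \<lambda>b\<in>Basis. x \<bullet> b)) =
      sets (\<Pi>\<^sub>M b\<in>(Basis::'a set). density lborel std_normal_density)"
      by (auto intro!: sets_PiM_cong)
    fix E :: "'a \<Rightarrow> real set"
    assume "\<And>b. b \<in> Basis \<Longrightarrow> E b \<in> sets (density lborel (\<lambda>x. ennreal (std_normal_density x)))"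
    then have [measurable]: "\<And>b. b \<in> Basis \<Longrightarrow> E b \<in> sets borel" by simp
    have "emeasure (distr std_gauss (\<Pi>\<^sub>M b\<in>(Basis::'a set). borel) (\<lambda>x. \<lambda>b\<in>Basis. x \<bullet> b)) (Pi\<^sub>E Basis E)
        = emeasure std_gauss {x. \<forall>b\<in>Basis. x \<bullet> b \<in> E b}"
      by (subst emeasure_distr) (auto intro!: arg_cong[of _ _ "emeasure _"] sets_PiM_I_finite)
    then show "emeasure (distr std_gauss (\<Pi>\<^sub>M b\<in>(Basis::'a set). borel) (\<lambda>x. \<lambda>b\<in>Basis. x \<bullet> b)) (Pi\<^sub>E Basis E)
        = (\<Prod>b\<in>Basis. emeasure (density lborel std_normal_density) (E b))"
      by (simp add: emeasure_std_gauss_box)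
  qed simp
  also have "\<dots> = (\<Pi>\<^sub>M b\<in>(Basis::'a set). distr std_gauss borel (\<lambda>x. x \<bullet> b))"
    by (intro PiM_cong refl) (simp add: distr_std_gauss_component)
  finally show ?thesis
    by (subst std_gauss.indep_vars_iff_distr_eq_PiM') auto
qed

text \<open>No rotation argument is used: \<open>x \<bullet> e\<close> is a sum of independent
  centred normal variables with standard deviations \<open>\<bar>e \<bullet> b\<bar>\<close>, whose
  variances add up to the squared norm of \<open>e\<close>, which is 1.\<close>

lemma distr_std_gauss_inner:
  fixes e :: "'a::euclidean_space"
  assumes "norm e = 1"
  shows "distr std_gauss borel (\<lambda>x. x \<bullet> e) = density lborel std_normal_density"
proof -
  \<comment> \<open>Directions orthogonal to \<open>e\<close> are dropped: their summands are
    constantly 0 and have no normal density, whereas the sum rule asks for positive standard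
    deviations.\<close>
  define I where "I = {b\<in>Basis. e \<bullet> b \<noteq> 0}"
  have "e \<noteq> 0" using assms by auto
  then have "I \<noteq> {}" using euclidean_all_zero_iff[of e] by (auto simp: I_def)
  have sum_sq: "(\<Sum>b\<in>I. \<bar>e \<bullet> b\<bar>\<^sup>2) = 1"
  proof -
    have "(\<Sum>b\<in>I. \<bar>e \<bullet> b\<bar>\<^sup>2) = (\<Sum>b\<in>Basis. (e \<bullet> b) * (e \<bullet> b))"
      by (rule sum.mono_neutral_cong_left) (auto simp: I_def power2_eq_square)
    also have "\<dots> = 1"
      using assms by (simp add: euclidean_inner[symmetric] dot_square_norm)
    finally show ?thesis .
  qed
  have indep: "std_gauss.indep_vars (\<lambda>_. borel) (\<lambda>b x. (e \<bullet> b) * (x \<bullet> b)) I"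
    by (rule std_gauss.indep_vars_compose2[OF
          std_gauss.indep_vars_subset[OF indep_vars_std_gauss], where Y = "\<lambda>b t. (e \<bullet> b) * t"])
       (auto simp: I_def)
  have normal: "distributed std_gauss lborel (\<lambda>x. (e \<bullet> b) * (x \<bullet> b)) (normal_density 0 \<bar>e \<bullet> b\<bar>)"
    if "b \<in> I" for b
  proof -
    have "distributed std_gauss lborel (\<lambda>x. x \<bullet> b) std_normal_density"
      using that distr_std_gauss_component[of b]
      by (auto simp: distributed_def I_def cong: distr_cong)
    from std_gauss.normal_density_affine[OF this, of "e \<bullet> b" 0] that
    show ?thesis by (simp add: I_def)
  qed
  have "distributed std_gauss lborel (\<lambda>x. \<Sum>b\<in>I. (e \<bullet> b) * (x \<bullet> b))
      (normal_density (\<Sum>b\<in>I. 0) (sqrt (\<Sum>b\<in>I. \<bar>e \<bullet> b\<bar>\<^sup>2)))"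
    by (rule std_gauss.sum_indep_normal[OF _ \<open>I \<noteq> {}\<close> indep _ normal]) (auto simp: I_def)
  moreover have "(\<lambda>x. \<Sum>b\<in>I. (e \<bullet> b) * (x \<bullet> b)) = (\<lambda>x. x \<bullet> e)"
  proof
    fix x
    have "(\<Sum>b\<in>I. (e \<bullet> b) * (x \<bullet> b)) = (\<Sum>b\<in>Basis. (x \<bullet> b) * (e \<bullet> b))"
      by (rule sum.mono_neutral_cong_left) (auto simp: I_def)
    then show "(\<Sum>b\<in>I. (e \<bullet> b) * (x \<bullet> b)) = x \<bullet> e" by (simp add: euclidean_inner[symmetric])
  qed
  ultimately show ?thesis
    by (simp only: sum_sq) (auto simp: distributed_def cong: distr_cong)
qed

text \<open>Closed and open half-spaces are both needed, since the overlap is computed below over a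
  half-space and its complement.\<close>

lemma emeasure_std_gauss_halfspace:
  fixes e :: "'a::euclidean_space"
  assumes "norm e = 1"
  shows "emeasure std_gauss {x. x \<bullet> e \<le> a} = ennreal (std_normal_cdf a)"
    and "emeasure std_gauss {x. x \<bullet> e < a} = ennreal (std_normal_cdf a)"
proof -
  interpret N: prob_space "density lborel std_normal_density"
    by (rule prob_space_normal_density) simp
  have cdf: "emeasure (density lborel std_normal_density) {..a} = ennreal (std_normal_cdf a)"
  proof -
    have int: "integrable lborel (\<lambda>x. indicator {..a} x * std_normal_density x)"
      using integrable_mult_indicator[of "{..a}" lborel std_normal_density] by simp
    have "emeasure (density lborel std_normal_density) {..a}
        = (\<integral>\<^sup>+x. ennreal (indicator {..a} x * std_normal_density x) \<partial>lborel)"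
      by (subst emeasure_density) (auto intro!: nn_integral_cong simp: indicator_def)
    also have "\<dots> = ennreal (LINT x|lborel. indicator {..a} x * std_normal_density x)"
      by (rule nn_integral_eq_integral[OF int]) auto
    also have "(LINT x|lborel. indicator {..a} x * std_normal_density x) = std_normal_cdf a"
      by (simp add: std_normal_cdf_def set_lebesgue_integral_def std_normal_density_def)
    finally show ?thesis .
  qed
  \<comment> \<open>The two half-lines differ by one point, a Lebesgue null set.\<close>
  have "emeasure (density lborel std_normal_density) {..<a} = emeasure (density lborel std_normal_density) {..a}"
    using AE_lborel_singleton[of a]
    by (auto simp: emeasure_density indicator_def intro!: nn_integral_cong_AE)
  then have cdf': "emeasure (density lborel std_normal_density) {..<a} = ennreal (std_normal_cdf a)"
    using cdf by simp
  have "emeasure std_gauss {x. x \<bullet> e \<le> a} = emeasure (distr std_gauss borel (\<lambda>x. x \<bullet> e)) {..a}"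
    by (subst emeasure_distr) (auto intro!: arg_cong[of _ _ "emeasure _"])
  then show "emeasure std_gauss {x. x \<bullet> e \<le> a} = ennreal (std_normal_cdf a)"
    using cdf distr_std_gauss_inner[OF assms] by simp
  have "emeasure std_gauss {x. x \<bullet> e < a} = emeasure (distr std_gauss borel (\<lambda>x. x \<bullet> e)) {..<a}"
    by (subst emeasure_distr) (auto intro!: arg_cong[of _ _ "emeasure _"])
  then show "emeasure std_gauss {x. x \<bullet> e < a} = ennreal (std_normal_cdf a)"
    using cdf' distr_std_gauss_inner[OF assms] by simp
qed

section \<open>Mass of the overlap of a standard Gaussian density and its translate\<close>

lemma std_normal_cdf_nonneg: "0 \<le> std_normal_cdf a"
  unfolding std_normal_cdf_def set_lebesgue_integral_def by (rule Bochner_Integration.integral_nonneg) auto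

lemma nn_integral_lborel_shift:
  fixes f :: "'a::euclidean_space \<Rightarrow> ennreal"
  assumes [measurable]: "f \<in> borel_measurable borel"
  shows "(\<integral>\<^sup>+x. f (c + x) \<partial>lborel) = (\<integral>\<^sup>+x. f x \<partial>lborel)"
  using nn_integral_distr[of "(+) c" lborel borel f] by (simp add: lborel_distr_plus)

text \<open>The overlap splits along the perpendicular bisector of \<open>0\<close> and \<open>- \<theta>\<close>: on either side the
  density centred farther away is the smaller one, and both sides have mass
  \<open>cdf (- norm \<theta> / 2)\<close> by the symmetry of the distribution.\<close>

lemma nn_integral_min_std_gauss_density:
  fixes \<theta> :: "'a::euclidean_space"
  shows "(\<integral>\<^sup>+x. min (ennreal (std_gauss_density x)) (ennreal (std_gauss_density (x + \<theta>))) \<partial>lborel)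
    = ennreal (2 * std_normal_cdf (- (1 / 2) * norm \<theta>))"
proof -
  define r where "r = norm \<theta>"
  \<comment> \<open>For \<open>\<theta> = 0\<close> the direction is arbitrary; any unit vector
    works because \<open>r = 0\<close>.\<close>
  obtain e where e: "norm e = 1" "\<theta> = r *\<^sub>R e"
  proof (cases "\<theta> = 0")
    case True
    obtain e :: 'a where "norm e = 1" using norm_Basis SOME_Basis by blast
    then show ?thesis using that True by (auto simp: r_def)
  next
    case False
    then show ?thesis using that[of "\<theta> /\<^sub>R r"] by (auto simp: r_def)
  qed
  have "r \<ge> 0" by (simp add: r_def)
  have ee: "e \<bullet> e = 1" using e(1) by (simp add: norm_eq_1)
  let ?g = "\<lambda>x. ennreal (std_gauss_density x)"
  \<comment> \<open>As \<open>r\<close> is nonnegative, the sign of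
    \<open>x \<bullet> e + r / 2\<close> decides which of \<open>x\<close> and
    \<open>x + \<theta>\<close> is closer to the origin, and hence by \<open>le\<close> which
    density is smaller.\<close>
  have sq: "(x + \<theta>) \<bullet> (x + \<theta>) = x \<bullet> x + 2 * r * (x \<bullet> e + r / 2)" for x
  proof -
    have "(x + \<theta>) \<bullet> (x + \<theta>) = x \<bullet> x + 2 * (x \<bullet> \<theta>) + \<theta> \<bullet> \<theta>"
      by (simp only: inner_add inner_commute[of \<theta> x])
    also have "\<dots> = x \<bullet> x + 2 * r * (x \<bullet> e + r / 2)"
      by (simp only: e(2) inner_scaleR_left inner_scaleR_right ee) (simp add: field_simps)
    finally show ?thesis .
  qed
  have le: "?g x \<le> ?g y" if "y \<bullet> y \<le> x \<bullet> x" for x y :: 'a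
    unfolding std_gauss_density_eq using that by (intro ennreal_leI divide_right_mono) auto
  \<comment> \<open>The second summand is written entirely in \<open>\<theta> + x\<close>, so that
    translation invariance turns it into the mass of a half-space with normal \<open>- e\<close>. In
    that variable the complement \<open>x \<bullet> e > - r / 2\<close> again has threshold
    \<open>- r / 2\<close>, which makes the two masses equal.\<close>
  have "(\<integral>\<^sup>+x. min (?g x) (?g (x + \<theta>)) \<partial>lborel)
     = (\<integral>\<^sup>+x. ?g x * indicator {x. x \<bullet> e \<le> - r / 2} x
         + ?g (\<theta> + x) * indicator {x. x \<bullet> - e < - r / 2} (\<theta> + x) \<partial>lborel)"
  proof (rule nn_integral_cong)
    fix x :: 'a
    have 1: "(\<theta> + x) \<bullet> - e < - r / 2 \<longleftrightarrow> \<not> x \<bullet> e \<le> - r / 2"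
      by (simp add: e(2) inner_add ee) linarith
    show "min (?g x) (?g (x + \<theta>)) = ?g x * indicator {x. x \<bullet> e \<le> - r / 2} x
         + ?g (\<theta> + x) * indicator {x. x \<bullet> - e < - r / 2} (\<theta> + x)"
    proof (cases "x \<bullet> e \<le> - r / 2")
      case True
      then have "?g x \<le> ?g (x + \<theta>)"
        using mult_nonneg_nonpos[OF \<open>r \<ge> 0\<close>, of "x \<bullet> e + r / 2"] by (intro le) (simp add: sq)
      then show ?thesis using True 1 by (simp add: min_absorb1)
    next
      case False
      then have "?g (x + \<theta>) \<le> ?g x"
        using mult_nonneg_nonneg[OF \<open>r \<ge> 0\<close>, of "x \<bullet> e + r / 2"] by (intro le) (simp add: sq)
      then show ?thesis using False 1 by (simp add: min_absorb2 add.commute)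
    qed
  qed
  also have "\<dots> = (\<integral>\<^sup>+x. ?g x * indicator {x. x \<bullet> e \<le> - r / 2} x \<partial>lborel)
      + (\<integral>\<^sup>+x. ?g (\<theta> + x) * indicator {x. x \<bullet> - e < - r / 2} (\<theta> + x) \<partial>lborel)"
    by (rule nn_integral_add) measurable
  also have "(\<integral>\<^sup>+x. ?g (\<theta> + x) * indicator {x. x \<bullet> - e < - r / 2} (\<theta> + x) \<partial>lborel)
      = (\<integral>\<^sup>+x. ?g x * indicator {x. x \<bullet> - e < - r / 2} x \<partial>lborel)"
    by (rule nn_integral_lborel_shift) measurable
  also have "(\<integral>\<^sup>+x. ?g x * indicator {x. x \<bullet> e \<le> - r / 2} x \<partial>lborel) = emeasure std_gauss {x. x \<bullet> e \<le> - r / 2}"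
    unfolding std_gauss_def by (rule emeasure_density[symmetric]) measurable
  also have "(\<integral>\<^sup>+x. ?g x * indicator {x. x \<bullet> - e < - r / 2} x \<partial>lborel) = emeasure std_gauss {x. x \<bullet> - e < - r / 2}"
    unfolding std_gauss_def by (rule emeasure_density[symmetric]) measurable
  also have "emeasure std_gauss {x. x \<bullet> e \<le> - r / 2} + emeasure std_gauss {x. x \<bullet> - e < - r / 2}
     = ennreal (2 * std_normal_cdf (- (1 / 2) * norm \<theta>))"
    using emeasure_std_gauss_halfspace(1)[OF e(1), of "- r / 2"]
      emeasure_std_gauss_halfspace(2)[of "- e" "- r / 2"] e(1)
    by (simp add: r_def ennreal_plus[symmetric] std_normal_cdf_nonneg del: ennreal_plus inner_minus_right)
  finally show ?thesis .
qed


section \<open>The coupling as an image of the overlap\<close>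

lemma pair_measure_return:
  assumes "x \<in> space M" "y \<in> space N"
  shows "return M x \<Otimes>\<^sub>M return N y = return (M \<Otimes>\<^sub>M N) (x, y)"
proof (rule measure_eqI)
  interpret N: prob_space "return N y" by (rule prob_space_return) fact
  fix E assume "E \<in> sets (return M x \<Otimes>\<^sub>M return N y)"
  then have E: "E \<in> sets (M \<Otimes>\<^sub>M N)" by (simp cong: sets_pair_measure_cong)
  have "emeasure (return M x \<Otimes>\<^sub>M return N y) E = (\<integral>\<^sup>+a. emeasure (return N y) (Pair a -` E) \<partial>return M x)"
    using E by (intro N.emeasure_pair_measure_alt) (simp cong: sets_pair_measure_cong)
  also have "\<dots> = (\<integral>\<^sup>+a. indicator E (a, y) \<partial>return M x)"
    using E by (intro nn_integral_cong) (auto simp: sets_Pair1 indicator_def)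
  also have "\<dots> = indicator E (x, y)"
    using E assms by (subst nn_integral_return) auto
  finally show "emeasure (return M x \<Otimes>\<^sub>M return N y) E = emeasure (return (M \<Otimes>\<^sub>M N) (x, y)) E"
    using E by simp
qed (simp cong: sets_pair_measure_cong)

section \<open>Gaussians with identity covariance and their minimum\<close>

lemma gaussian_mat_1:
  "gaussian m (mat 1 :: real ^ 'n ^ 'n) = density lborel (\<lambda>x. ennreal (std_gauss_density (x - m)))"
proof -
  \<comment> \<open>\<open>matrix_inv\<close> is a Hilbert choice, so its value follows from
    uniqueness of the inverse.\<close>
  have "matrix_inv (mat 1 :: real ^ 'n ^ 'n) = mat 1"
    unfolding matrix_inv_def by (rule some_equality) auto
  then show ?thesis
    by (simp add: gaussian_def std_gauss_density_eq)
qed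

text \<open>The mean enters only through the map applied to a fixed noise \<open>std_gauss\<close>;
  measurability of the transition kernels thereby reduces to measurability of an image measure in
  its map.\<close>

lemma gaussian_eq_distr: "gaussian m (mat 1) = distr std_gauss borel ((+) m)"
proof -
  have "gaussian m (mat 1) = density (distr lborel borel ((+) m)) (\<lambda>x. ennreal (std_gauss_density (x - m)))"
    by (simp add: gaussian_mat_1 lborel_distr_plus)
  also have "\<dots> = distr std_gauss borel ((+) m)"
    by (subst density_distr) (simp_all add: std_gauss_def)
  finally show ?thesis .
qed

lemma sets_gaussian [measurable_cong, simp]: "sets (gaussian m \<Sigma>) = sets borel"
  by (simp add: gaussian_def)

lemma space_gaussian [simp]: "space (gaussian m \<Sigma>) = UNIV"
  by (simp add: gaussian_def)

lemma emeasure_gaussian: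
  assumes "S \<in> sets borel"
  shows "emeasure (gaussian m (mat 1)) S = emeasure std_gauss {w. m + w \<in> S}"
  using assms by (simp add: gaussian_eq_distr emeasure_distr vimage_def)

lemma measurable_gaussian [measurable (raw)]:
  assumes [measurable]: "f \<in> borel_measurable M"
  shows "(\<lambda>x. gaussian (f x) (mat 1)) \<in> M \<rightarrow>\<^sub>M prob_algebra borel"
  unfolding gaussian_eq_distr
proof (rule measurable_distr_prob_space2)
  show "(\<lambda>x. std_gauss) \<in> M \<rightarrow>\<^sub>M prob_algebra borel"
    by (rule measurable_const) (simp add: space_prob_algebra prob_space_std_gauss)
qed measurable

text \<open>Radon-Nikodym derivatives are determined only almost everywhere, which is enough to
  replace them by the explicit densities under \<open>density\<close>.\<close>

lemma min_measure_gaussian: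
  "min_measure (gaussian 0 (mat 1)) (gaussian (- \<theta>) (mat 1)) =
    density lborel (\<lambda>x. min (ennreal (std_gauss_density x)) (ennreal (std_gauss_density (x + \<theta>))))"
proof -
  have "AE x in lborel. ennreal (std_gauss_density (x - m)) = RN_deriv lborel (gaussian m (mat 1)) x"
    for m :: "real ^ 'n"
    by (rule sigma_finite_measure.RN_deriv_unique[OF sigma_finite_lborel]) (simp_all add: gaussian_mat_1)
  from this[of 0] this[of "- \<theta>"] show ?thesis
    unfolding min_measure_def by (intro density_cong) auto
qed

lemma sets_min_measure [measurable_cong, simp]: "sets (min_measure \<mu> \<nu>) = sets borel"
  by (simp add: min_measure_def)

lemma space_min_measure [simp]: "space (min_measure \<mu> \<nu>) = UNIV"
  by (simp add: min_measure_def)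

text \<open>The minimum lies below each of its two densities. Both bounds are phrased with
  \<open>std_gauss\<close>, the second one as a translate by \<open>- \<theta>\<close>.\<close>

lemma min_measure_gaussian_le:
  assumes [measurable]: "S \<in> sets borel"
  shows "emeasure (min_measure (gaussian 0 (mat 1)) (gaussian (- \<theta>) (mat 1))) S \<le> emeasure std_gauss S"
    and "emeasure (min_measure (gaussian 0 (mat 1)) (gaussian (- \<theta>) (mat 1))) S
      \<le> emeasure std_gauss {w. - \<theta> + w \<in> S}"
proof -
  have "emeasure (min_measure (gaussian 0 (mat 1)) (gaussian (- \<theta>) (mat 1))) S
      \<le> emeasure (gaussian 0 (mat 1)) S"
    unfolding min_measure_gaussian unfolding gaussian_mat_1
    by (simp add: emeasure_density) (intro nn_integral_mono, auto simp: indicator_def)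
  then show "emeasure (min_measure (gaussian 0 (mat 1)) (gaussian (- \<theta>) (mat 1))) S \<le> emeasure std_gauss S"
    by (simp add: emeasure_gaussian)
  have "emeasure (min_measure (gaussian 0 (mat 1)) (gaussian (- \<theta>) (mat 1))) S
      \<le> emeasure (gaussian (- \<theta>) (mat 1)) S"
    unfolding min_measure_gaussian unfolding gaussian_mat_1
    by (simp add: emeasure_density) (intro nn_integral_mono, auto simp: indicator_def)
  then show "emeasure (min_measure (gaussian 0 (mat 1)) (gaussian (- \<theta>) (mat 1))) S
      \<le> emeasure std_gauss {w. - \<theta> + w \<in> S}"
    by (simp add: emeasure_gaussian)
qed

lemma emeasure_min_measure_gaussian_UNIV:
  "emeasure (min_measure (gaussian 0 (mat 1)) (gaussian (- \<theta>) (mat 1))) UNIV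
    = ennreal (2 * std_normal_cdf (- (1 / 2) * norm \<theta>))"
  unfolding min_measure_gaussian
  by (simp add: emeasure_density nn_integral_min_std_gauss_density)

text \<open>The left side is the mass of the overlap, which is dominated by a probability measure;
  no symmetry or monotonicity of the cdf has to be shown.\<close>

lemma two_std_normal_cdf_le_1: "2 * std_normal_cdf (- (1 / 2) * norm (\<theta> :: real ^ 'n)) \<le> 1"
  using min_measure_gaussian_le(1)[of UNIV \<theta>] std_gauss.emeasure_space_1[where 'a="real ^ 'n"]
  unfolding emeasure_min_measure_gaussian_UNIV by simp

lemma subprob_space_min_measure_gaussian:
  "subprob_space (min_measure (gaussian 0 (mat 1)) (gaussian (- \<theta>) (mat 1)))"
  using two_std_normal_cdf_le_1[of \<theta>] emeasure_min_measure_gaussian_UNIV[of \<theta>]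
  by (intro subprob_spaceI) (simp_all del: mult_minus_left)

text \<open>Given \<open>w\<close>, all the inner measures are Dirac measures, so the binds only
  substitute \<open>\<theta> + w\<close> for \<open>w'\<close> and leave the image of the overlap
  under one map.\<close>

lemma shift_coupling_eq_distr:
  "shift_coupling A B \<theta> x' x u =
    distr (min_measure (gaussian 0 (mat 1)) (gaussian (- \<theta>) (mat 1))) (borel \<Otimes>\<^sub>M borel)
      (\<lambda>w. (A *v x' + B *v u + \<theta> + w, A *v x + B *v u + \<theta> + w))"
proof -
  let ?f = "\<lambda>w. (A *v x' + B *v u + (\<theta> + w), A *v x + B *v u + \<theta> + w)"
  have "return borel (\<theta> + w) \<bind> (\<lambda>w'.
      return borel (A *v x' + B *v u + w') \<Otimes>\<^sub>M return borel (A *v x + B *v u + \<theta> + w))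
    = return (borel \<Otimes>\<^sub>M borel) (?f w)" for w
    by (simp add: pair_measure_return)
       (rule bind_return[where N = "borel \<Otimes>\<^sub>M borel"], auto)
  then show ?thesis
    unfolding shift_coupling_def same_input_def Let_def
    by (simp add: bind_return_distr' add.assoc)
qed

section \<open>The linear models\<close>

lemma borel_of_top_euclidean [simp]:
  "borel_of_top euclidean = (borel :: 'a::topological_space measure)"
  by (simp add: borel_of_top_def borel_def)

lemma space_borel_of_top [simp]: "space (borel_of_top T) = topspace T"
  by (simp add: borel_of_top_def space_measure_of_conv)

text \<open>Traces on \<open>U\<close> of open sets are open in \<open>U\<close>. This carries maps
  that are measurable on the whole space over to the input space, whose sigma-algebra comes from the
  subspace topology.\<close>

lemma borel_of_top_top_of_set_id [measurable]: "(\<lambda>u. u) \<in> borel_of_top (top_of_set U) \<rightarrow>\<^sub>M borel"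
proof (rule borel_measurableI)
  fix S :: "'a set" assume "open S"
  then have "openin (top_of_set U) (S \<inter> U)" by (auto simp: openin_open)
  moreover have "{T. openin (top_of_set U) T} \<subseteq> Pow U" by (auto dest: openin_imp_subset)
  ultimately show "(\<lambda>u. u) -` S \<inter> space (borel_of_top (top_of_set U)) \<in> sets (borel_of_top (top_of_set U))"
    by (simp add: borel_of_top_def space_measure_of_conv sets_measure_of sigma_sets.Basic)
qed

lemma borel_measurable_matrix_vector_mult [measurable (raw)]:
  fixes A :: "real ^ 'm ^ 'n"
  assumes "f \<in> borel_measurable M"
  shows "(\<lambda>x. A *v f x) \<in> borel_measurable M"
  by (rule measurable_compose[OF assms borel_measurable_continuous_onI])
     (rule matrix_vector_mult_linear_continuous_on)

lemma polish_topology_euclidean: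
  "polish_topology (euclidean :: 'a::{complete_space, second_countable_topology} topology)"
proof -
  obtain \<B> :: "'a set set" where \<B>: "countable \<B>" "\<And>C. C \<in> \<B> \<Longrightarrow> open C"
    "\<And>S. open S \<Longrightarrow> \<exists>U. U \<subseteq> \<B> \<and> S = \<Union>U"
    by (metis univ_second_countable)
  have "second_countable (euclidean :: 'a topology)"
    unfolding second_countable_def
  proof (intro exI[of _ \<B>] conjI ballI allI impI)
    fix S and x :: 'a assume "openin euclidean S \<and> x \<in> S"
    then show "\<exists>V\<in>\<B>. x \<in> V \<and> V \<subseteq> S"
      using \<B>(3)[of S] by auto
  qed (use \<B> in auto)
  then show ?thesis
    by (simp add: polish_topology_def completely_metrizable_space_euclidean)
qed

lemma is_gmdp_linear_model:
  assumes "polish_topology (top_of_set U)" and "Metric_space UNIV d"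
  shows "is_gmdp (linear_model A B C U d x0 \<theta>)"
proof -
  have "(\<lambda>u. B *v u) \<in> borel_measurable (borel_of_top (top_of_set U))"
    by (rule borel_measurable_matrix_vector_mult) (rule borel_of_top_top_of_set_id)
  note [measurable] = this
  have "(\<lambda>(x, u). gaussian (A *v x + B *v u + \<theta>) (mat 1)) \<in>
      borel \<Otimes>\<^sub>M borel_of_top (top_of_set U) \<rightarrow>\<^sub>M prob_algebra borel"
    unfolding case_prod_unfold by (rule measurable_gaussian) measurable
  moreover have "(*v) C \<in> borel \<rightarrow>\<^sub>M borel" by measurable
  ultimately show ?thesis
    using assms unfolding is_gmdp_def linear_model_def
    by (simp add: polish_topology_euclidean)
qed

text \<open>As the case of zero offset, the nominal model inherits every fact about
  \<open>linear_model\<close>.\<close>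

lemma nominal_model_eq: "nominal_model A B C U d x0 = linear_model A B C U d x0 0"
  by (simp add: nominal_model_def linear_model_def)

text \<open>The diagonal is closed, and by second countability the product sigma-algebra is the
  Borel algebra of the product.\<close>

lemma diagonal_in_sets_borel:
  "{(x', x). x = x'} \<in> sets (borel \<Otimes>\<^sub>M (borel :: 'a::{second_countable_topology, t2_space} measure))"
proof -
  have "{(x', x). x = x'} = {y. \<exists>x::'a. y = (x, x)}" by auto
  then show ?thesis
    unfolding borel_prod using borel_closed[OF closed_diagonal] by simp
qed

text \<open>A fixed sub-probability measure is pushed along a map that is jointly measurable in the
  parameters and \<open>w\<close>. The offsets of the two models are arbitrary, as only state and
  input spaces enter.\<close>

lemma is_subprob_kernel_shift_coupling:
  fixes A :: "real ^ 'n ^ 'n" and B :: "real ^ 'm ^ 'n"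
  shows "is_subprob_kernel (linear_model A B C U d x0 \<theta>\<^sub>1) (linear_model A B C U d x0 \<theta>\<^sub>2) (shift_coupling A B \<theta>)"
proof -
  have "(\<lambda>u. B *v u) \<in> borel_measurable (borel_of_top (top_of_set U))"
    by (rule borel_measurable_matrix_vector_mult) (rule borel_of_top_top_of_set_id)
  note [measurable] = this
  let ?L = "borel \<Otimes>\<^sub>M borel \<Otimes>\<^sub>M borel_of_top (top_of_set U) :: ((real ^ 'n) \<times> (real ^ 'n) \<times> (real ^ 'm)) measure"
  have "(\<lambda>p. distr (min_measure (gaussian 0 (mat 1)) (gaussian (- \<theta>) (mat 1))) (borel \<Otimes>\<^sub>M borel)
      (\<lambda>w. (A *v fst p + B *v snd (snd p) + \<theta> + w, A *v fst (snd p) + B *v snd (snd p) + \<theta> + w)))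
    \<in> ?L \<rightarrow>\<^sub>M subprob_algebra (borel \<Otimes>\<^sub>M borel)"
  proof (rule measurable_distr2[where M = borel])
    show "(\<lambda>p. min_measure (gaussian 0 (mat 1)) (gaussian (- \<theta>) (mat 1))) \<in> ?L \<rightarrow>\<^sub>M subprob_algebra borel"
      by (rule measurable_const)
         (simp add: space_subprob_algebra subprob_space_min_measure_gaussian)
  qed measurable
  then show ?thesis
    unfolding is_subprob_kernel_def shift_coupling_eq_distr
    by (simp add: linear_model_def case_prod_unfold)
qed

section \<open>Coupling, sub-simulation and refinement\<close>

lemma emeasure_shift_coupling:
  assumes "S \<in> sets (borel \<Otimes>\<^sub>M borel)"
  shows "emeasure (shift_coupling A B \<theta> x' x u) S =
    emeasure (min_measure (gaussian 0 (mat 1)) (gaussian (- \<theta>) (mat 1)))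
      {w. (A *v x' + B *v u + \<theta> + w, A *v x + B *v u + \<theta> + w) \<in> S}"
  using assms unfolding shift_coupling_eq_distr
  by (subst emeasure_distr) (auto simp: vimage_def measurable_Pair cong: measurable_cong_sets)

lemma subprob_coupling_shift_coupling:
  assumes "0 \<le> \<delta>" "\<delta> \<le> 1" "1 - 2 * std_normal_cdf (- (1 / 2) * norm \<theta>) \<le> \<delta>"
  shows "subprob_coupling \<delta> {(x', x). x = x'} (gaussian (A *v x + B *v u) (mat 1))
    (gaussian (A *v x + B *v u + \<theta>) (mat 1)) (shift_coupling A B \<theta> x x u)"
proof -
  let ?\<mu> = "min_measure (gaussian 0 (mat 1)) (gaussian (- \<theta>) (mat 1))"
  let ?v = "shift_coupling A B \<theta> x x u"
  have sets_v: "sets ?v = sets (borel \<Otimes>\<^sub>M borel)" by (simp add: shift_coupling_eq_distr)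
  have space_v: "space ?v = UNIV" using sets_eq_imp_space_eq[OF sets_v] by (simp add: space_pair_measure)
  have mass: "emeasure ?v UNIV = ennreal (2 * std_normal_cdf (- (1 / 2) * norm \<theta>))"
    using emeasure_shift_coupling[of UNIV A B \<theta> x x u] emeasure_min_measure_gaussian_UNIV[of \<theta>]
      sets.top[of "borel \<Otimes>\<^sub>M borel :: ((real ^ 'a) \<times> (real ^ 'a)) measure"]
    by (simp add: space_pair_measure)
  \<comment> \<open>With equal states the two components agree for every \<open>w\<close>, so the
    preimage of the diagonal is the whole noise space.\<close>
  have diag: "emeasure ?v {(x', x). x = x'} = emeasure ?v UNIV"
    using emeasure_shift_coupling[OF diagonal_in_sets_borel, of A B \<theta> x x u]
      mass emeasure_min_measure_gaussian_UNIV[of \<theta>] by simp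
  have fst: "emeasure ?v (S \<times> UNIV) \<le> emeasure (gaussian (A *v x + B *v u) (mat 1)) S"
    if [measurable]: "S \<in> sets borel" for S
  proof -
    have "emeasure ?v (S \<times> UNIV) = emeasure ?\<mu> {w. A *v x + B *v u + \<theta> + w \<in> S}"
      by (subst emeasure_shift_coupling) auto
    \<comment> \<open>Here the bound by the Gaussian centred at \<open>- \<theta>\<close> is used:
      its shift cancels the offset and leaves the nominal mean.\<close>
    also have "\<dots> \<le> emeasure std_gauss {w. - \<theta> + w \<in> {w. A *v x + B *v u + \<theta> + w \<in> S}}"
      by (rule min_measure_gaussian_le) measurable
    also have "\<dots> = emeasure (gaussian (A *v x + B *v u) (mat 1)) S"
      by (simp add: emeasure_gaussian add.assoc)
    finally show ?thesis .
  qed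
  have snd: "emeasure ?v (UNIV \<times> S) \<le> emeasure (gaussian (A *v x + B *v u + \<theta>) (mat 1)) S"
    if [measurable]: "S \<in> sets borel" for S
  proof -
    have "emeasure ?v (UNIV \<times> S) = emeasure ?\<mu> {w. A *v x + B *v u + \<theta> + w \<in> S}"
      by (subst emeasure_shift_coupling) auto
    \<comment> \<open>The bound by the centred Gaussian keeps the offset, as the true transition
      requires.\<close>
    also have "\<dots> \<le> emeasure std_gauss {w. A *v x + B *v u + \<theta> + w \<in> S}"
      by (rule min_measure_gaussian_le) measurable
    also have "\<dots> = emeasure (gaussian (A *v x + B *v u + \<theta>) (mat 1)) S"
      by (simp add: emeasure_gaussian)
    finally show ?thesis .
  qed
  show ?thesis
    unfolding subprob_coupling_def
    using assms sets_v diagonal_in_sets_borel mass diag fst snd two_std_normal_cdf_le_1[of \<theta>]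
    by (auto simp: space_v ennreal_leI simp del: mult_minus_left cong: sets_pair_measure_cong)
qed

text \<open>Stated for any admissible \<open>\<delta>\<close> above the mass deficit at this one
  \<open>\<theta>\<close>, so that the supremum enters only at the end.\<close>

lemma sub_simulation_linear_model:
  assumes U: "polish_topology (top_of_set U)" and d: "Metric_space UNIV d"
    and \<delta>: "0 \<le> \<delta>" "\<delta> \<le> 1" "1 - 2 * std_normal_cdf (- (1 / 2) * norm \<theta>) \<le> \<delta>"
  shows "sub_simulation 0 \<delta> (nominal_model A B C U d x0) (linear_model A B C U d x0 \<theta>)
    {(x', x). x = x'} same_input (shift_coupling A B \<theta>)"
proof -
  let ?M = "linear_model A B C U d x0"
  have "{(x', x). x = x'} \<in> sets (borel_of_top (states (?M 0)) \<Otimes>\<^sub>M borel_of_top (states (?M \<theta>)))"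
    using diagonal_in_sets_borel by (simp add: linear_model_def)
  moreover have "is_interface (?M 0) (?M \<theta>) same_input"
    unfolding is_interface_def by (simp add: linear_model_def same_input_def case_prod_unfold)
  moreover have "subprob_coupling \<delta> {(x', x). x = x'} (trans_kernel (?M 0) x u)
      (trans_kernel (?M \<theta>) x (same_input x x u)) (shift_coupling A B \<theta> x x u)" for x u
    using subprob_coupling_shift_coupling[OF \<delta>] by (simp add: linear_model_def same_input_def)
  moreover have "d y y = 0" for y
    using Metric_space.mdist_zero[OF d] by simp
  then have "out_metric (?M \<theta>) (out_map (?M 0) x) (out_map (?M \<theta>) x) \<le> 0" for x
    by (simp add: linear_model_def)
  moreover have "init_state (?M \<theta>) = init_state (?M 0)" "outputs (?M \<theta>) = outputs (?M 0)"
    "out_metric (?M \<theta>) = out_metric (?M 0)"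
    by (simp_all add: linear_model_def)
  ultimately show ?thesis
    unfolding sub_simulation_def nominal_model_eq
    using is_gmdp_linear_model[OF U d] is_subprob_kernel_shift_coupling by auto
qed

lemma valid_control_refinement_linear_model:
  fixes A :: "real ^ 'n ^ 'n" and B :: "real ^ 'm ^ 'n"
  shows "valid_control_refinement (nominal_model A B C U d x0) (linear_model A B C U d x0 \<theta>)
    {(x', x). x = x'} same_input (shift_coupling A B \<theta>) (refinement_map A B)"
proof -
  have refinement_map: "refinement_map A B x' x y u = return borel (y - A *v (x - x'))" for x' x y u
    by (simp add: refinement_map_def same_input_def)
  have "(\<lambda>p. return borel (fst (snd (snd p)) - A *v (fst (snd p) - fst p))) \<in>
      borel \<Otimes>\<^sub>M borel \<Otimes>\<^sub>M borel \<Otimes>\<^sub>M borel_of_top (top_of_set U) \<rightarrow>\<^sub>M prob_algebra borel"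
    by measurable
  then have meas: "(\<lambda>(x', x, y, u'). refinement_map A B x' x y u') \<in>
      borel_of_top euclidean \<Otimes>\<^sub>M borel_of_top euclidean
         \<Otimes>\<^sub>M borel_of_top euclidean \<Otimes>\<^sub>M borel_of_top (top_of_set U)
         \<rightarrow>\<^sub>M prob_algebra (borel_of_top euclidean)"
    by (simp add: refinement_map case_prod_unfold)
  have le: "emeasure (shift_coupling A B \<theta> x x u) S \<le>
      (\<integral>\<^sup>+ y. \<integral>\<^sup>+ y'. indicator S (y', y) \<partial>refinement_map A B x x y u
        \<partial>gaussian (A *v x + B *v u + \<theta>) (mat 1))"
    if [measurable]: "S \<in> sets (borel \<Otimes>\<^sub>M borel)" for S x u
  proof -
    let ?m = "A *v x + B *v u + \<theta>"
    have [measurable]: "{y. (y, y) \<in> S} \<in> sets borel"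
      using measurable_sets[of "\<lambda>y. (y, y)" borel "borel \<Otimes>\<^sub>M borel" S] that by (simp add: vimage_def)
    \<comment> \<open>On the diagonal \<open>A *v (x - x)\<close> vanishes, so the state mapping is
      the Dirac measure at \<open>y\<close> and the refined pair is \<open>(y, y)\<close>.\<close>
    have "(\<integral>\<^sup>+ y. \<integral>\<^sup>+ y'. indicator S (y', y) \<partial>refinement_map A B x x y u \<partial>gaussian ?m (mat 1))
        = (\<integral>\<^sup>+ y. indicator {y. (y, y) \<in> S} y \<partial>gaussian ?m (mat 1))"
      by (intro nn_integral_cong) (simp add: refinement_map nn_integral_return indicator_def)
    also have "\<dots> = emeasure (gaussian ?m (mat 1)) {y. (y, y) \<in> S}"
      by (rule nn_integral_indicator) simp
    also have "\<dots> = emeasure std_gauss {w. (?m + w, ?m + w) \<in> S}"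
      by (subst emeasure_gaussian) auto
    also have "\<dots> \<ge> emeasure (shift_coupling A B \<theta> x x u) S"
      unfolding emeasure_shift_coupling[OF that] by (rule min_measure_gaussian_le) measurable
    finally show ?thesis .
  qed
  show ?thesis
    unfolding valid_control_refinement_def nominal_model_eq
    using meas le by (auto simp: linear_model_def same_input_def)
qed

theorem theorem3:
  fixes A :: "real ^ 'n ^ 'n" and B :: "real ^ 'm ^ 'n" and C :: "real ^ 'n ^ 'p"
    and U :: "(real ^ 'm) set" and \<Theta> :: "(real ^ 'n) set"
    and d :: "real ^ 'p \<Rightarrow> real ^ 'p \<Rightarrow> real" and x0 :: "real ^ 'n"
    and \<delta> \<epsilon> :: real and R :: "((real ^ 'n) \<times> (real ^ 'n)) set"
  assumes "polish_topology (top_of_set U)"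
    and "polytope \<Theta>"
    and "Metric_space UNIV d"
    and "\<delta> = (SUP \<theta>\<in>\<Theta>. 1 - 2 * std_normal_cdf (- (1 / 2) * norm \<theta>))"
    and "\<epsilon> = 0"
    and "R = {(x', x). x = x'}"
  shows "\<forall>\<theta>\<in>\<Theta>.
    sub_simulation \<epsilon> \<delta> (nominal_model A B C U d x0) (linear_model A B C U d x0 \<theta>) R
      same_input (shift_coupling A B \<theta>) \<and>
    valid_control_refinement (nominal_model A B C U d x0) (linear_model A B C U d x0 \<theta>) R
      same_input (shift_coupling A B \<theta>) (refinement_map A B)"
proof
  fix \<theta> assume "\<theta> \<in> \<Theta>"
  let ?f = "\<lambda>\<theta> :: real ^ 'n. 1 - 2 * std_normal_cdf (- (1 / 2) * norm \<theta>)"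
  have f: "0 \<le> ?f \<theta>" "?f \<theta> \<le> 1" for \<theta>
    using two_std_normal_cdf_le_1[of \<theta>] std_normal_cdf_nonneg[of "- (1 / 2) * norm \<theta>"] by auto
  \<comment> \<open>A real supremum bounds its members only if they are bounded above; here 1 is a
    bound because the cdf is nonnegative.\<close>
  have "?f \<theta> \<le> \<delta>"
    unfolding assms(4) by (rule cSUP_upper[OF \<open>\<theta> \<in> \<Theta>\<close>]) (rule bdd_aboveI2[OF f(2)])
  moreover from this f(1)[of \<theta>] have "0 \<le> \<delta>" by linarith
  \<comment> \<open>The chosen \<open>\<theta>\<close> makes the index set nonempty, without which
    the supremum of reals would not be controlled by the bound.\<close>
  moreover have "\<delta> \<le> 1"
    unfolding assms(4) using \<open>\<theta> \<in> \<Theta>\<close> by (intro cSUP_least f(2)) auto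
  ultimately show "sub_simulation \<epsilon> \<delta> (nominal_model A B C U d x0) (linear_model A B C U d x0 \<theta>) R
      same_input (shift_coupling A B \<theta>) \<and>
    valid_control_refinement (nominal_model A B C U d x0) (linear_model A B C U d x0 \<theta>) R
      same_input (shift_coupling A B \<theta>) (refinement_map A B)"
    unfolding assms(5,6)
    by (intro conjI sub_simulation_linear_model assms(1,3) valid_control_refinement_linear_model)
qed

end
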